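(* For every finite non-commutative ring $R$, the non-commuting graph $\Gamma_R$ is not a complete bipartite graph.
   Context: Rings are associative and not assumed to have a unity. For a ring $R$, $Z(R)=\{x\in R : xr=rx \text{ for all } r\in R\}$ is its center. The non-commuting graph $\Gamma_R$ of a finite ring $R$ is the simple undirected graph with vertex set $R\setminus Z(R)$ in which two distinct vertices $a,b$ are adjacent if and only if $ab\neq ba$. A bipartite graph is a graph whose vertex set can be partitioned into two disjoint parts such that the two end vertices of every edge lie in different parts. A complete bipartite graph is a bipartite graph (with such a partition) in which two vertices are adjacent if and only if they lie in different parts. *)

theory Defs
  imports "Graph_Theory.Graph_Theory"
begin

text \<open>
  The type class \<open>ring\<close> provides associative rings without a unity assumption
  (the unital class is \<open>ring_1\<close>; the rings of HOL-Algebra are unital).  A finite ring is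
  a type of sort \<open>{ring, finite}\<close>.
\<close>

definition ring_center :: "'a::ring set" where
  "ring_center = {x. \<forall>r. x * r = r * x}"

text \<open>
  Following the library's convention, a simple undirected graph is a loop-free symmetric
  digraph without parallel arcs: each edge is represented by both of its orientations.
\<close>

definition non_commuting_graph :: "'a::ring pair_pre_digraph" where
  "non_commuting_graph =
     \<lparr> pverts = UNIV - ring_center,
       parcs = {(a, b). a \<in> UNIV - ring_center \<and> b \<in> UNIV - ring_center \<and>
                        a \<noteq> b \<and> a * b \<noteq> b * a} \<rparr>"

text \<open>
  The library predicate \<^const>\<open>complete_bipartite_digraph\<close> includes the requirement that its
  argument is a (finite, simple, undirected) graph; by the next lemma this holds here, so that
  negating the predicate really denies complete bipartiteness.
\<close>

lemma pair_graph_non_commuting_graph: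
  "pair_graph (non_commuting_graph :: 'a::{ring,finite} pair_pre_digraph)"
  by unfold_locales
    (auto simp: non_commuting_graph_def symmetric_def intro!: symI)

text \<open>The sizes of the two parts are existentially quantified.\<close>

definition complete_bipartite :: "('a, 'b) pre_digraph \<Rightarrow> bool" where
  "complete_bipartite G \<longleftrightarrow> (\<exists>m n. complete_bipartite_digraph m n G)"

lemma complete_bipartite_pair_graph_iff:
  assumes "pair_graph G"
  shows "complete_bipartite (with_proj G) \<longleftrightarrow>
    (\<exists>U V. pverts G = U \<union> V \<and> U \<inter> V = {} \<and>
      (\<forall>a\<in>pverts G. \<forall>b\<in>pverts G.
        (a, b) \<in> parcs G \<longleftrightarrow> a \<in> U \<and> b \<in> V \<or> a \<in> V \<and> b \<in> U))"
proof -
  interpret pair_graph G by fact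
  have *: "parcs G = U \<times> V \<union> V \<times> U \<longleftrightarrow>
      (\<forall>a\<in>pverts G. \<forall>b\<in>pverts G.
        (a, b) \<in> parcs G \<longleftrightarrow> a \<in> U \<and> b \<in> V \<or> a \<in> V \<and> b \<in> U)"
    if "pverts G = U \<union> V" for U V
  proof
    show "parcs G = U \<times> V \<union> V \<times> U" if A: "\<forall>a\<in>pverts G. \<forall>b\<in>pverts G.
        (a, b) \<in> parcs G \<longleftrightarrow> a \<in> U \<and> b \<in> V \<or> a \<in> V \<and> b \<in> U"
    proof (rule set_eqI, clarify)
      fix a b
      show "(a, b) \<in> parcs G \<longleftrightarrow> (a, b) \<in> U \<times> V \<union> V \<times> U"
        using A \<open>pverts G = U \<union> V\<close> in_arcsD1[of a b] in_arcsD2[of a b] by blast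
    qed
  qed auto
  show ?thesis
    unfolding complete_bipartite_def complete_bipartite_digraph_pair_def
    using pair_finite_verts * by meson
qed

end

theory Submission
  imports Defs
begin

text \<open>
  Two elements \<open>a\<close>, \<open>b\<close> that do not commute span a triangle: commuting with \<open>a + b\<close> is, for
  \<open>a\<close> as for \<open>b\<close>, the same as commuting with the other one, so \<open>a\<close>, \<open>b\<close> and \<open>a + b\<close> are
  pairwise non-commuting.  A bipartite graph contains no triangle, because two of the three
  vertices would have to lie in the same part.  The argument therefore excludes
  bipartiteness of any kind, not only complete bipartiteness.
\<close>

lemma parcs_non_commuting_graph_iff:
  "(a, b) \<in> parcs non_commuting_graph \<longleftrightarrow> a * b \<noteq> b * a"
  by (simp add: non_commuting_graph_def ring_center_def) metis

lemma triangle_in_non_commuting_graph: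
  fixes a b :: "'a::ring"
  assumes "a * b \<noteq> b * a"
  shows "(a, b) \<in> parcs non_commuting_graph"
    and "(a, a + b) \<in> parcs non_commuting_graph"
    and "(b, a + b) \<in> parcs non_commuting_graph"
  using assms by (auto simp: parcs_non_commuting_graph_iff distrib_left distrib_right)

theorem theorem2p3:
  assumes "\<exists>a b :: 'a::{ring,finite}. a * b \<noteq> b * a"
  shows "\<not> complete_bipartite (with_proj (non_commuting_graph :: 'a pair_pre_digraph))"
proof
  let ?G = "non_commuting_graph :: 'a pair_pre_digraph"
  interpret pair_graph ?G by (rule pair_graph_non_commuting_graph)
  assume "complete_bipartite (with_proj ?G)"
  then obtain U V where disjoint: "U \<inter> V = {}"
    and edge: "\<forall>x\<in>pverts ?G. \<forall>y\<in>pverts ?G.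
      (x, y) \<in> parcs ?G \<longleftrightarrow> x \<in> U \<and> y \<in> V \<or> x \<in> V \<and> y \<in> U"
    unfolding complete_bipartite_pair_graph_iff[OF pair_graph_non_commuting_graph] by blast
  have separated: "x \<in> U \<and> y \<in> V \<or> x \<in> V \<and> y \<in> U" if "(x, y) \<in> parcs ?G" for x y
    using edge that in_arcsD1[OF that] in_arcsD2[OF that] by blast
  obtain a b :: 'a where "a * b \<noteq> b * a"
    using assms by blast
  note triangle = triangle_in_non_commuting_graph[OF this]
  show False
    using triangle[THEN separated] disjoint by blast
qed

end
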